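(* Let $\mathcal{H}_1, \mathcal{H}_2, \mathcal{K}_1, \mathcal{K}_2$ be closed subspaces of $L^2$ and let $a_1, a_2 \in \mathscr{G}L^\infty$ with $a_1 \mathcal{K}_1 = \mathcal{H}_1$ and $a_2\mathcal{K}_2 = \mathcal{H}_2$. If $\phi, \psi \in \mathscr{G}L^\infty$ with $\phi = \bar a_2 \psi a_1$, then $$T_\phi^{\mathcal{K}_1,\mathcal{K}_2} = E\, T_\psi^{\mathcal{H}_1,\mathcal{H}_2}\, F,$$ where $$E = T_{\bar a_2}^{\mathcal{H}_2,\mathcal{K}_2} \quad\text{and}\quad F = T_{a_1}^{\mathcal{K}_1,\mathcal{H}_1} = M_{a_1}|_{\mathcal{K}_1}.$$ Thus the generalized Toeplitz operators $T_\phi^{\mathcal{K}_1,\mathcal{K}_2}$ and $T_\psi^{\mathcal{H}_1,\mathcal{H}_2}$ are equivalent (with $E$ and $F$ bounded and invertible).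
   Context: $L^2 = L^2(\mathbb{T}, m)$, with $m$ normalized Lebesgue measure on the unit circle $\mathbb{T}$, and $L^\infty = L^\infty(\mathbb{T},m)$ (complex-valued functions). $\mathscr{G}L^\infty = \{g \in L^\infty : 1/g \in L^\infty\}$. $M_a$ is the multiplication operator $f\mapsto af$ on $L^2$, and $a\mathcal{K} = \{af: f \in \mathcal{K}\}$. $P_{\mathcal{N}}$ is the orthogonal projection of $L^2$ onto the closed subspace $\mathcal{N}$. For closed subspaces $\mathcal{M}, \mathcal{N}$ of $L^2$ and $\phi \in L^\infty$, the generalized Toeplitz operator is $T_\phi^{\mathcal{M},\mathcal{N}} : \mathcal{M} \to \mathcal{N}$, $T_\phi^{\mathcal{M},\mathcal{N}} f = P_{\mathcal{N}}(\phi f)$. Bounded operators $A : \mathcal{X}_1 \to \mathcal{X}_2$ and $B : \mathcal{Y}_1 \to \mathcal{Y}_2$ between Hilbert spaces are equivalent if there are bounded invertible operators $E : \mathcal{Y}_2 \to \mathcal{X}_2$ and $F : \mathcal{X}_1 \to \mathcal{Y}_1$ with $A = EBF$. *)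

theory Defs
  imports "HOL-Probability.Probability"
begin

section \<open>The space \<open>L\<^sup>2\<close> of the unit circle\<close>

(* The image of normalized arc length on [0, 2 pi) under t |-> exp(i t), completed so that
   measurability means Lebesgue measurability. *)
definition circle :: "complex measure" where
  "circle = completion (distr (uniform_measure lborel {0..<2 * pi})
                              (restrict_space borel (sphere 0 1)) cis)"

definition square_integrable :: "(complex \<Rightarrow> complex) \<Rightarrow> bool" where
  "square_integrable f \<longleftrightarrow>
     f \<in> borel_measurable circle \<and> integrable circle (\<lambda>z. (norm (f z))\<^sup>2)"

definition L2_rel :: "(complex \<Rightarrow> complex) \<Rightarrow> (complex \<Rightarrow> complex) \<Rightarrow> bool" where
  "L2_rel f g \<longleftrightarrow> square_integrable f \<and> square_integrable g \<and> (AE z in circle. f z = g z)"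

lemma borel_measurable_cnj [measurable]: "cnj \<in> borel_measurable borel"
  by (intro borel_measurable_continuous_onI continuous_intros)

lemma square_integrable_zero: "square_integrable (\<lambda>_. 0)"
  by (simp add: square_integrable_def)

lemma square_integrable_mult_bounded:
  assumes "square_integrable f" "a \<in> borel_measurable circle" "AE z in circle. norm (a z) \<le> C"
  shows "square_integrable (\<lambda>z. a z * f z)"
proof -
  have [measurable]: "f \<in> borel_measurable circle" "a \<in> borel_measurable circle"
    using assms by (auto simp: square_integrable_def)
  have "integrable circle (\<lambda>z. C\<^sup>2 * (norm (f z))\<^sup>2)"
    using assms by (simp add: square_integrable_def)
  moreover have "AE z in circle. norm ((norm (a z * f z))\<^sup>2) \<le> norm (C\<^sup>2 * (norm (f z))\<^sup>2)"
    using assms(3)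
    by eventually_elim (auto simp: norm_mult power_mult_distrib intro!: mult_right_mono power_mono)
  ultimately have "integrable circle (\<lambda>z. (norm (a z * f z))\<^sup>2)"
    by (intro Bochner_Integration.integrable_bound[where
          g = "\<lambda>z. (norm (a z * f z))\<^sup>2" and f = "\<lambda>z. C\<^sup>2 * (norm (f z))\<^sup>2"]) auto
  then show ?thesis
    by (simp add: square_integrable_def)
qed

lemma square_integrable_cmult:
  "square_integrable f \<Longrightarrow> square_integrable (\<lambda>z. c * f z)"
  by (rule square_integrable_mult_bounded[where C = "norm c"]) auto

lemma square_integrable_add:
  assumes "square_integrable f" "square_integrable g"
  shows "square_integrable (\<lambda>z. f z + g z)"
proof -
  have [measurable]: "f \<in> borel_measurable circle" "g \<in> borel_measurable circle"
    using assms by (auto simp: square_integrable_def)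
  have "integrable circle (\<lambda>z. 2 * (norm (f z))\<^sup>2 + 2 * (norm (g z))\<^sup>2)"
    using assms by (simp add: square_integrable_def)
  moreover have "norm ((norm (f z + g z))\<^sup>2) \<le> norm (2 * (norm (f z))\<^sup>2 + 2 * (norm (g z))\<^sup>2)" for z
  proof -
    have "(norm (f z + g z))\<^sup>2 \<le> (norm (f z) + norm (g z))\<^sup>2"
      by (intro power_mono norm_triangle_ineq) auto
    also have "\<dots> \<le> 2 * (norm (f z))\<^sup>2 + 2 * (norm (g z))\<^sup>2"
      using zero_le_power2[of "norm (f z) - norm (g z)"] by (simp add: power2_sum power2_diff)
    finally show ?thesis by simp
  qed
  ultimately have "integrable circle (\<lambda>z. (norm (f z + g z))\<^sup>2)"
    by (intro Bochner_Integration.integrable_bound[where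
          g = "\<lambda>z. (norm (f z + g z))\<^sup>2" and f = "\<lambda>z. 2 * (norm (f z))\<^sup>2 + 2 * (norm (g z))\<^sup>2"]) auto
  then show ?thesis
    by (simp add: square_integrable_def)
qed

lemma square_integrable_uminus: "square_integrable f \<Longrightarrow> square_integrable (\<lambda>z. - f z)"
  using square_integrable_cmult[of f "-1"] by simp

lemma square_integrable_diff:
  "square_integrable f \<Longrightarrow> square_integrable g \<Longrightarrow> square_integrable (\<lambda>z. f z - g z)"
  using square_integrable_add[of f "\<lambda>z. - g z"] square_integrable_uminus[of g] by simp

lemma square_integrable_integrable_mult_cnj:
  assumes "square_integrable f" "square_integrable g"
  shows "integrable circle (\<lambda>z. f z * cnj (g z))"
proof -
  have [measurable]: "f \<in> borel_measurable circle" "g \<in> borel_measurable circle"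
    using assms by (auto simp: square_integrable_def)
  have "integrable circle (\<lambda>z. (norm (f z))\<^sup>2 + (norm (g z))\<^sup>2)"
    using assms by (simp add: square_integrable_def)
  moreover have "norm (f z * cnj (g z)) \<le> norm ((norm (f z))\<^sup>2 + (norm (g z))\<^sup>2)" for z
  proof -
    have "norm (f z) * norm (g z) \<le> 2 * norm (f z) * norm (g z)"
      by simp
    also have "\<dots> \<le> (norm (f z))\<^sup>2 + (norm (g z))\<^sup>2"
      by (rule sum_squares_bound)
    finally show ?thesis by (simp add: norm_mult)
  qed
  moreover have "(\<lambda>z. f z * cnj (g z)) \<in> borel_measurable circle"
    by measurable
  ultimately show ?thesis
    by (intro Bochner_Integration.integrable_bound[where
          g = "\<lambda>z. f z * cnj (g z)" and f = "\<lambda>z. (norm (f z))\<^sup>2 + (norm (g z))\<^sup>2"]) auto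
qed

quotient_type L2 = "complex \<Rightarrow> complex" / partial: L2_rel
proof (rule part_equivpI)
  show "\<exists>f. L2_rel f f"
    using square_integrable_zero by (auto simp: L2_rel_def)
  show "symp L2_rel"
    by (auto simp: symp_def L2_rel_def)
  show "transp L2_rel"
  proof (rule transpI)
    fix f g h assume "L2_rel f g" "L2_rel g h"
    then have "AE z in circle. f z = g z" "AE z in circle. g z = h z"
      by (auto simp: L2_rel_def)
    then have "AE z in circle. f z = h z"
      by eventually_elim simp
    with \<open>L2_rel f g\<close> \<open>L2_rel g h\<close> show "L2_rel f h"
      by (simp add: L2_rel_def)
  qed
qed

lift_definition L2_scaleC :: "complex \<Rightarrow> L2 \<Rightarrow> L2" is "\<lambda>c f z. c * f z"
  by (auto simp: L2_rel_def intro: square_integrable_cmult)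

lift_definition L2_cinner :: "L2 \<Rightarrow> L2 \<Rightarrow> complex" is
  "\<lambda>f g. \<integral>z. f z * cnj (g z) \<partial>circle"
proof -
  fix f f' g g' assume fg: "L2_rel f f'" "L2_rel g g'"
  then have [measurable]: "f \<in> borel_measurable circle" "f' \<in> borel_measurable circle"
      "g \<in> borel_measurable circle" "g' \<in> borel_measurable circle"
    by (auto simp: L2_rel_def square_integrable_def)
  from fg have "AE z in circle. f z = f' z" "AE z in circle. g z = g' z"
    by (auto simp: L2_rel_def)
  then have "AE z in circle. f z * cnj (g z) = f' z * cnj (g' z)"
    by eventually_elim simp
  then show "(\<integral>z. f z * cnj (g z) \<partial>circle) = (\<integral>z. f' z * cnj (g' z) \<partial>circle)"
    by (intro integral_cong_AE) measurable
qed

(* The real inner product Re <f, g> induces the usual norm, hence the usual topology, of the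
   complex Hilbert space L2. *)
instantiation L2 :: real_inner
begin

lift_definition zero_L2 :: L2 is "\<lambda>_. 0"
  by (simp add: L2_rel_def square_integrable_zero)

lift_definition plus_L2 :: "L2 \<Rightarrow> L2 \<Rightarrow> L2" is "\<lambda>f g z. f z + g z"
  by (auto simp: L2_rel_def intro: square_integrable_add)

lift_definition uminus_L2 :: "L2 \<Rightarrow> L2" is "\<lambda>f z. - f z"
  by (auto simp: L2_rel_def intro: square_integrable_uminus)

lift_definition minus_L2 :: "L2 \<Rightarrow> L2 \<Rightarrow> L2" is "\<lambda>f g z. f z - g z"
  by (auto simp: L2_rel_def intro: square_integrable_diff)

definition scaleR_L2 :: "real \<Rightarrow> L2 \<Rightarrow> L2" where
  "scaleR_L2 r = L2_scaleC (complex_of_real r)"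

definition inner_L2 :: "L2 \<Rightarrow> L2 \<Rightarrow> real" where
  "inner_L2 f g = Re (L2_cinner f g)"

definition norm_L2 :: "L2 \<Rightarrow> real" where
  "norm_L2 f = sqrt (inner f f)"

definition sgn_L2 :: "L2 \<Rightarrow> L2" where
  "sgn_L2 f = inverse (norm f) *\<^sub>R f"

definition dist_L2 :: "L2 \<Rightarrow> L2 \<Rightarrow> real" where
  "dist_L2 f g = norm (f - g)"

definition uniformity_L2 :: "(L2 \<times> L2) filter" where
  "uniformity_L2 = (INF e\<in>{0<..}. principal {(x, y). dist x y < e})"

definition open_L2 :: "L2 set \<Rightarrow> bool" where
  "open_L2 U = (\<forall>x\<in>U. \<forall>\<^sub>F (x', y) in uniformity. x' = x \<longrightarrow> y \<in> U)"

instance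
proof
  fix f g h :: L2 and r s :: real
  show "dist f g = norm (f - g)" by (rule dist_L2_def)
  show "f + g + h = f + (g + h)"
    by transfer (auto simp: L2_rel_def add.assoc intro: square_integrable_add)
  show "f + g = g + f"
    by transfer (auto simp: L2_rel_def add.commute intro: square_integrable_add)
  show "0 + f = f"
    by transfer (auto simp: L2_rel_def)
  show "- f + f = 0"
    by transfer (auto simp: L2_rel_def square_integrable_zero)
  show "f - g = f + - g"
    by transfer (auto simp: L2_rel_def intro: square_integrable_diff)
  show "r *\<^sub>R (f + g) = r *\<^sub>R f + r *\<^sub>R g"
    unfolding scaleR_L2_def
    by transfer (auto simp: L2_rel_def distrib_left
        intro: square_integrable_add square_integrable_cmult)
  show "(r + s) *\<^sub>R f = r *\<^sub>R f + s *\<^sub>R f"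
    unfolding scaleR_L2_def
    by transfer (auto simp: L2_rel_def distrib_right
        intro: square_integrable_add square_integrable_cmult)
  show "r *\<^sub>R s *\<^sub>R f = (r * s) *\<^sub>R f"
    unfolding scaleR_L2_def
    by transfer (auto simp: L2_rel_def mult.assoc intro: square_integrable_cmult)
  show "1 *\<^sub>R f = f"
    unfolding scaleR_L2_def by transfer (auto simp: L2_rel_def)
  show "sgn f = inverse (norm f) *\<^sub>R f" by (rule sgn_L2_def)
  show "uniformity = (INF e\<in>{0<..}. principal {(x :: L2, y). dist x y < e})"
    by (rule uniformity_L2_def)
  show "open U = (\<forall>x\<in>U. \<forall>\<^sub>F (x', y) in uniformity. x' = x \<longrightarrow> y \<in> U)" for U :: "L2 set"
    by (rule open_L2_def)
  show "norm f = sqrt (inner f f)" by (rule norm_L2_def)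
  have cnj_sym: "L2_cinner g f = cnj (L2_cinner f g)"
  proof transfer
    fix f g :: "complex \<Rightarrow> complex"
    have "(\<integral>z. g z * cnj (f z) \<partial>circle) = (\<integral>z. cnj (f z * cnj (g z)) \<partial>circle)"
      by (simp add: mult.commute)
    also have "\<dots> = cnj (\<integral>z. f z * cnj (g z) \<partial>circle)"
      by (rule Bochner_Integration.integral_cnj)
    finally show "(\<integral>z. g z * cnj (f z) \<partial>circle) = cnj (\<integral>z. f z * cnj (g z) \<partial>circle)" .
  qed
  show "inner f g = inner g f"
    unfolding inner_L2_def by (simp add: cnj_sym)
  have "L2_cinner (f + g) h = L2_cinner f h + L2_cinner g h"
    by transfer (simp add: L2_rel_def distrib_right square_integrable_integrable_mult_cnj)
  then show "inner (f + g) h = inner f h + inner g h"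
    unfolding inner_L2_def by simp
  have "L2_cinner (r *\<^sub>R f) g = r * L2_cinner f g"
    unfolding scaleR_L2_def by transfer (simp add: mult.assoc)
  then show "inner (r *\<^sub>R f) g = r * inner f g"
    unfolding inner_L2_def by simp
  have sq: "L2_cinner f f = complex_of_real (\<integral>z. (norm (F z))\<^sup>2 \<partial>circle)"
    if "f = abs_L2 F" "L2_rel F F" for F
    using that by (simp add: L2_cinner.abs_eq complex_norm_square[symmetric]
        flip: integral_complex_of_real of_real_power)
  obtain F where F: "f = abs_L2 F" "L2_rel F F"
    by (metis Quotient_L2 Quotient_abs_rep Quotient_rep_reflp)
  have int: "integrable circle (\<lambda>z. (norm (F z))\<^sup>2)"
    using F by (simp add: L2_rel_def square_integrable_def)
  show "0 \<le> inner f f"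
    unfolding inner_L2_def by (simp add: sq[OF F])
  have "inner f f = 0 \<longleftrightarrow> (AE z in circle. (norm (F z))\<^sup>2 = 0)"
    unfolding inner_L2_def by (simp add: sq[OF F] integral_nonneg_eq_0_iff_AE[OF int])
  also have "\<dots> \<longleftrightarrow> L2_rel F (\<lambda>_. 0)"
    using F by (simp add: L2_rel_def square_integrable_zero)
  also have "\<dots> \<longleftrightarrow> f = 0"
    using F Quotient_rel[OF Quotient_L2, of F "\<lambda>_. 0"]
    by (auto simp: zero_L2_def L2_rel_def square_integrable_zero)
  finally show "inner f f = 0 \<longleftrightarrow> f = 0" .
qed

end

definition closed_csubspace :: "L2 set \<Rightarrow> bool" where
  "closed_csubspace M \<longleftrightarrow> 0 \<in> M \<and> (\<forall>f\<in>M. \<forall>g\<in>M. f + g \<in> M) \<and>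
     (\<forall>c. \<forall>f\<in>M. L2_scaleC c f \<in> M) \<and> closed M"

section \<open>Symbols and multiplication operators\<close>

(* Elements of L-infinity are given by representatives; equality of two symbols is to be read as
   equality almost everywhere. *)
definition Linf :: "(complex \<Rightarrow> complex) set" where
  "Linf = {a. a \<in> borel_measurable circle \<and> (\<exists>C. AE z in circle. norm (a z) \<le> C)}"

(* The condition that g does not vanish is needed since 1 / 0 = 0. *)
definition GLinf :: "(complex \<Rightarrow> complex) set" where
  "GLinf = {g \<in> Linf. (AE z in circle. g z \<noteq> 0) \<and> (\<lambda>z. 1 / g z) \<in> Linf}"

(* Symbols outside Linf get the dummy value 0. *)
lift_definition mult_op :: "(complex \<Rightarrow> complex) \<Rightarrow> L2 \<Rightarrow> L2" is
  "\<lambda>a f. if a \<in> Linf then (\<lambda>z. a z * f z) else (\<lambda>_. 0)"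
proof -
  fix a f g assume fg: "L2_rel f g"
  show "L2_rel (if a \<in> Linf then (\<lambda>z. a z * f z) else (\<lambda>_. 0))
               (if a \<in> Linf then (\<lambda>z. a z * g z) else (\<lambda>_. 0))"
  proof (cases "a \<in> Linf")
    case True
    then obtain C where "a \<in> borel_measurable circle" "AE z in circle. norm (a z) \<le> C"
      by (auto simp: Linf_def)
    moreover have "AE z in circle. a z * f z = a z * g z"
      using fg by (auto simp: L2_rel_def)
    ultimately show ?thesis
      using True fg by (auto simp: L2_rel_def intro: square_integrable_mult_bounded)
  qed (simp add: L2_rel_def square_integrable_zero)
qed

section \<open>Operators between closed subspaces\<close>

(* An operator M -> N is a function on M, extended by undefined outside M; composition of such
   operators is compose from HOL-Library.FuncSet. *)

definition orth_proj :: "L2 set \<Rightarrow> L2 \<Rightarrow> L2" where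
  "orth_proj N f = (THE g. g \<in> N \<and> (\<forall>h\<in>N. L2_cinner (f - g) h = 0))"

definition toeplitz :: "L2 set \<Rightarrow> L2 set \<Rightarrow> (complex \<Rightarrow> complex) \<Rightarrow> L2 \<Rightarrow> L2" where
  "toeplitz M N \<phi> = (\<lambda>f\<in>M. orth_proj N (mult_op \<phi> f))"

definition bounded_operator :: "L2 set \<Rightarrow> L2 set \<Rightarrow> (L2 \<Rightarrow> L2) \<Rightarrow> bool" where
  "bounded_operator X Y A \<longleftrightarrow> A \<in> X \<rightarrow>\<^sub>E Y \<and>
     (\<forall>f\<in>X. \<forall>g\<in>X. A (f + g) = A f + A g) \<and>
     (\<forall>c. \<forall>f\<in>X. A (L2_scaleC c f) = L2_scaleC c (A f)) \<and>
     (\<exists>C. \<forall>f\<in>X. norm (A f) \<le> C * norm f)"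

definition invertible_operator :: "L2 set \<Rightarrow> L2 set \<Rightarrow> (L2 \<Rightarrow> L2) \<Rightarrow> bool" where
  "invertible_operator X Y A \<longleftrightarrow> bounded_operator X Y A \<and>
     (\<exists>B. bounded_operator Y X B \<and>
        compose X B A = (\<lambda>f\<in>X. f) \<and> compose Y A B = (\<lambda>g\<in>Y. g))"

definition equivalent_operators ::
    "L2 set \<Rightarrow> L2 set \<Rightarrow> (L2 \<Rightarrow> L2) \<Rightarrow> L2 set \<Rightarrow> L2 set \<Rightarrow> (L2 \<Rightarrow> L2) \<Rightarrow> bool" where
  "equivalent_operators X1 X2 A Y1 Y2 B \<longleftrightarrow>
     bounded_operator X1 X2 A \<and> bounded_operator Y1 Y2 B \<and>
     (\<exists>E F. invertible_operator Y2 X2 E \<and> invertible_operator X1 Y1 F \<and>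
        A = compose X1 E (compose X1 B F))"

end

theory Submission
  imports Defs
begin

text \<open>
  Everything rests on one identity (\<open>orth_proj_mult_cnj_orth_proj\<close>): if \<open>a\<close> maps the
  subspace \<open>K\<close> into \<open>H\<close>, then \<open>P\<^sub>K M\<^bsub>cnj a\<^esub> P\<^sub>H = P\<^sub>K M\<^bsub>cnj a\<^esub>\<close>.  Indeed
  \<open>M\<^bsub>cnj a\<^esub>\<close> is the adjoint of \<open>M\<^sub>a\<close>, so the part of a function orthogonal to \<open>H\<close>, which is
  orthogonal to \<open>a K\<close>, is sent by \<open>M\<^bsub>cnj a\<^esub>\<close> to something orthogonal to \<open>K\<close>.

  The identity yields the factorization: on \<open>K1\<close> the operator \<open>F\<close> is plain multiplication by
  \<open>a1\<close>, and the inner projection in \<open>P\<^bsub>K2\<^esub> (cnj a2 \<cdot> P\<^bsub>H2\<^esub> (\<psi> \<cdot> a1 \<cdot> f))\<close> may be dropped,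
  leaving \<open>P\<^bsub>K2\<^esub> (\<phi> \<cdot> f)\<close>.  It also shows that \<open>E\<close> is invertible: with \<open>b = 1 / a2\<close> we have
  \<open>a2 K2 = H2\<close> and \<open>b H2 = K2\<close>, so dropping the inner projection in either order shows that the
  generalized Toeplitz operator with symbol \<open>cnj b\<close> from \<open>K2\<close> to \<open>H2\<close> is a two-sided inverse of
  \<open>E\<close>.  The inverse of \<open>F\<close> is multiplication by \<open>1 / a1\<close>.

  All of this presupposes that \<open>orth_proj N\<close>, which is a definite description, really is the
  orthogonal projection onto \<open>N\<close>.  That is the projection theorem
  (\<open>complete_subspace_orthogonal_decomposition\<close>) together with the completeness of \<open>L2\<close>
  (Riesz--Fischer), the one analytic ingredient.
\<close>

section \<open>Orthogonal projection in real inner product spaces\<close>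

text \<open>
  The projection theorem.  By the parallelogram law, points of \<open>S\<close> whose distance to \<open>f\<close> is
  nearly minimal are close to each other, so a minimizing sequence is Cauchy; moving its limit
  within \<open>S\<close> cannot decrease the distance, which forces orthogonality.
\<close>

lemma complete_subspace_orthogonal_decomposition:
  fixes S :: "'a::real_inner set"
  assumes "subspace S" and "Topological_Spaces.complete S"
  shows "\<exists>g\<in>S. \<forall>h\<in>S. inner (f - g) h = 0"
proof -
  define D where "D = (\<lambda>x. (norm (f - x))\<^sup>2) ` S"
  define d where "d = Inf D"
  have "0 \<in> S" using assms(1) by (rule subspace_0)
  then have "D \<noteq> {}" by (auto simp: D_def)
  have "bdd_below D" by (auto simp: D_def intro!: bdd_belowI[of _ 0])
  then have d_le: "d \<le> (norm (f - x))\<^sup>2" if "x \<in> S" for x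
    unfolding d_def using that by (intro cInf_lower) (auto simp: D_def)
  have "\<exists>x\<in>S. (norm (f - x))\<^sup>2 < d + 1 / real (Suc n)" for n
  proof -
    have "Inf D < d + 1 / real (Suc n)" by (simp add: d_def)
    then show ?thesis
      using cInf_lessD[OF \<open>D \<noteq> {}\<close>] by (auto simp: D_def)
  qed
  then obtain x where x_S: "x n \<in> S" and x_d: "(norm (f - x n))\<^sup>2 < d + 1 / real (Suc n)" for n
    by metis
  have x_dist: "(norm (x m - x n))\<^sup>2 \<le> 2 / real (Suc m) + 2 / real (Suc n)" for m n
  proof -
    \<comment> \<open>The midpoint lies in \<open>S\<close>, so it is no closer to \<open>f\<close> than the infimum allows.\<close>
    let ?y = "(1/2) *\<^sub>R (x m + x n)"
    have "?y \<in> S" using assms(1) x_S by (intro subspace_scale subspace_add)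
    then have "d \<le> (norm (f - ?y))\<^sup>2" by (rule d_le)
    moreover have "(norm (x m - x n))\<^sup>2 =
        2 * (norm (f - x m))\<^sup>2 + 2 * (norm (f - x n))\<^sup>2 - 4 * (norm (f - ?y))\<^sup>2"
      by (simp add: power2_norm_eq_inner algebra_simps inner_commute)
    ultimately show ?thesis using x_d[of m] x_d[of n] by simp
  qed
  have "Cauchy x"
  proof (rule metric_CauchyI)
    fix e :: real assume "0 < e"
    then obtain M where M: "1 / real (Suc M) < e\<^sup>2 / 4"
      using nat_approx_posE[of "e\<^sup>2 / 4"] by auto
    have "dist (x m) (x n) < e" if "m \<ge> M" "n \<ge> M" for m n
    proof -
      have "1 / real (Suc m) \<le> 1 / real (Suc M)" "1 / real (Suc n) \<le> 1 / real (Suc M)"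
        using that by (auto intro!: divide_left_mono)
      then have "(norm (x m - x n))\<^sup>2 < e\<^sup>2"
        using M x_dist[of m n] by simp
      then show ?thesis
        using \<open>0 < e\<close> by (simp add: dist_norm power_less_imp_less_base)
    qed
    then show "\<exists>M. \<forall>m\<ge>M. \<forall>n\<ge>M. dist (x m) (x n) < e" by blast
  qed
  with assms(2) x_S obtain g where "g \<in> S" and g: "x \<longlonglongrightarrow> g"
    unfolding complete_def by blast
  have g_min: "(norm (f - g))\<^sup>2 \<le> d"
  proof (rule LIMSEQ_le)
    show "(\<lambda>n. (norm (f - x n))\<^sup>2) \<longlonglongrightarrow> (norm (f - g))\<^sup>2"
      by (intro tendsto_intros g)
    show "(\<lambda>n. d + 1 / real (Suc n)) \<longlonglongrightarrow> d"
      using tendsto_add[OF tendsto_const LIMSEQ_inverse_real_of_nat, of d]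
      by (simp add: inverse_eq_divide)
    show "\<exists>N. \<forall>n\<ge>N. (norm (f - x n))\<^sup>2 \<le> d + 1 / real (Suc n)"
      using x_d less_imp_le by blast
  qed
  have "inner (f - g) h = 0" if "h \<in> S" for h
  proof (cases "h = 0")
    case False
    \<comment> \<open>Compare \<open>g\<close> with the closest point to \<open>f\<close> on the line through \<open>g\<close> in direction \<open>h\<close>.\<close>
    define t where "t = inner (f - g) h / inner h h"
    have mem: "g + t *\<^sub>R h \<in> S"
      using assms(1) \<open>g \<in> S\<close> that by (intro subspace_add subspace_scale)
    have expand: "(norm (u - t *\<^sub>R h))\<^sup>2 = (norm u)\<^sup>2 - 2 * t * inner u h + t * t * inner h h" for u
      by (simp add: power2_norm_eq_inner algebra_simps inner_commute)
    have "(norm (f - g))\<^sup>2 \<le> (norm (f - g - t *\<^sub>R h))\<^sup>2"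
      using order_trans[OF g_min d_le[OF mem]] by (simp only: diff_diff_eq)
    also have "\<dots> = (norm (f - g))\<^sup>2 - 2 * t * inner (f - g) h + t * t * inner h h"
      by (rule expand)
    also have "\<dots> = (norm (f - g))\<^sup>2 - (inner (f - g) h)\<^sup>2 / inner h h"
      using False by (simp add: t_def power2_eq_square)
    finally have "(inner (f - g) h)\<^sup>2 / inner h h \<le> 0" by simp
    then show ?thesis
      using False inner_gt_zero_iff[of h]
      by (smt (verit) divide_pos_pos zero_less_power2)
  qed simp
  with \<open>g \<in> S\<close> show ?thesis by blast
qed

section \<open>Completeness of \<open>L\<^sup>2\<close>\<close>

text \<open>
  The weighted sum \<open>\<Sum>n. 2 ^ n * (norm (F (Suc n) z - F n z))\<^sup>2\<close> has finite integral, hence is finite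
  almost everywhere.  Since \<open>x \<le> 2 ^ n * x\<^sup>2 + (1/2) ^ n\<close>, the increments are then absolutely
  summable.  Weighting in this way avoids the triangle inequality for infinite sums in \<open>L\<^sup>2\<close>.
\<close>

lemma AE_convergent_of_L2_fast_Cauchy:
  fixes F :: "nat \<Rightarrow> 'a \<Rightarrow> complex"
  assumes [measurable]: "\<And>n. F n \<in> borel_measurable M"
    and fast: "\<And>n. (\<integral>\<^sup>+z. ennreal ((norm (F (Suc n) z - F n z))\<^sup>2) \<partial>M) \<le> ennreal ((1/4) ^ n)"
  shows "AE z in M. convergent (\<lambda>n. F n z)"
proof -
  let ?u = "\<lambda>n z. 2 ^ n * (norm (F (Suc n) z - F n z))\<^sup>2"
  have "(\<integral>\<^sup>+z. ennreal (?u n z) \<partial>M) \<le> ennreal ((1/2) ^ n)" for n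
  proof -
    have "(\<integral>\<^sup>+z. ennreal (?u n z) \<partial>M)
        = ennreal (2 ^ n) * (\<integral>\<^sup>+z. ennreal ((norm (F (Suc n) z - F n z))\<^sup>2) \<partial>M)"
      by (subst nn_integral_cmult[symmetric]) (auto simp: ennreal_mult)
    also have "\<dots> \<le> ennreal (2 ^ n) * ennreal ((1/4) ^ n)"
      by (intro mult_left_mono fast) simp
    also have "\<dots> = ennreal ((1/2) ^ n)"
      by (simp add: ennreal_mult[symmetric] power_mult_distrib[symmetric])
    finally show ?thesis .
  qed
  then have "(\<Sum>n. \<integral>\<^sup>+z. ennreal (?u n z) \<partial>M) \<le> (\<Sum>n. ennreal ((1/2) ^ n))"
    by (intro suminf_le) auto
  also have "\<dots> < \<infinity>"
    by (simp add: suminf_ennreal2 less_top[symmetric])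
  finally have "(\<integral>\<^sup>+z. (\<Sum>n. ennreal (?u n z)) \<partial>M) \<noteq> \<infinity>"
    by (subst nn_integral_suminf) auto
  then have "AE z in M. (\<Sum>n. ennreal (?u n z)) \<noteq> \<infinity>"
    by (intro nn_integral_PInf_AE) auto
  then show ?thesis
  proof eventually_elim
    case (elim z)
    then have "summable (\<lambda>n. ?u n z)"
      by (intro summable_suminf_not_top) auto
    then have "summable (\<lambda>n. ?u n z + (1/2) ^ n)"
      by (intro summable_add summable_geometric) auto
    moreover have "norm (F (Suc n) z - F n z) \<le> ?u n z + (1/2) ^ n" for n
    proof -
      \<comment> \<open>The inequality of arithmetic and geometric means, in completed-square form.\<close>
      have "0 \<le> 2 ^ n * (norm (F (Suc n) z - F n z) - (1/2) ^ n)\<^sup>2"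
        by simp
      also have "\<dots> = ?u n z + (1/2) ^ n - 2 * norm (F (Suc n) z - F n z)"
        by (simp add: power2_eq_square algebra_simps power_one_over)
      finally show ?thesis
        using norm_ge_zero[of "F (Suc n) z - F n z"] by linarith
    qed
    ultimately have "summable (\<lambda>n. F (Suc n) z - F n z)"
      by (rule summable_comparison_test'[where N = 0])
    then have "convergent (\<lambda>n. F n z - F 0 z)"
      by (simp only: summable_iff_convergent sum_lessThan_telescope[of "\<lambda>n. F n z"])
    then show "convergent (\<lambda>n. F n z)"
      using convergent_add[OF _ convergent_const, of "\<lambda>n. F n z - F 0 z" "F 0 z"] by simp
  qed
qed

lemma L2_rel_rep: "L2_rel (rep_L2 f) (rep_L2 f)"
  by (rule Quotient_rep_reflp[OF Quotient_L2])

lemma abs_rep_L2: "abs_L2 (rep_L2 f) = f"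
  by (rule Quotient_abs_rep[OF Quotient_L2])

lemma square_integrable_rep_L2: "square_integrable (rep_L2 f)"
  using L2_rel_rep by (simp add: L2_rel_def)

lemma L2_cinner_self: "L2_cinner f f = complex_of_real ((norm f)\<^sup>2)"
proof -
  have "Im (L2_cinner f f) = 0"
    by transfer (simp only: complex_norm_square[symmetric] of_real_power[symmetric]
        integral_complex_of_real Im_complex_of_real)
  then show ?thesis
    by (simp add: power2_norm_eq_inner inner_L2_def complex_eq_iff)
qed

text \<open>
  Distances are expressed through the nonnegative integral so that Fatou's lemma applies to them
  and integrability of a limit can be deduced rather than assumed.
\<close>

lemma norm_diff_abs_L2:
  assumes "square_integrable F" and "square_integrable G"
  shows "ennreal ((norm (abs_L2 F - abs_L2 G))\<^sup>2) = (\<integral>\<^sup>+z. ennreal ((norm (F z - G z))\<^sup>2) \<partial>circle)"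
proof -
  have FG: "square_integrable (\<lambda>z. F z - G z)"
    using assms by (rule square_integrable_diff)
  have "complex_of_real ((norm (abs_L2 F - abs_L2 G))\<^sup>2)
      = complex_of_real (\<integral>z. (norm (F z - G z))\<^sup>2 \<partial>circle)"
    using assms FG
    by (simp add: L2_cinner_self[symmetric] minus_L2.abs_eq L2_cinner.abs_eq L2_rel_def
        complex_norm_square[symmetric] del: complex_cnj_diff
        flip: integral_complex_of_real of_real_power)
  then have "(norm (abs_L2 F - abs_L2 G))\<^sup>2 = (\<integral>z. (norm (F z - G z))\<^sup>2 \<partial>circle)"
    by (simp only: of_real_eq_iff)
  then show ?thesis
    using FG by (simp add: nn_integral_eq_integral square_integrable_def)
qed

text \<open>
  Riesz--Fischer: a rapidly converging subsequence has a pointwise limit \<open>G\<close> almost everywhere,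
  and Fatou's lemma applied to \<open>F m - F (r k)\<close> as \<open>k\<close> grows bounds the distance from \<open>F m\<close> to \<open>G\<close>.
\<close>

instance L2 :: complete_space
proof
  fix X :: "nat \<Rightarrow> L2" assume "Cauchy X"
  then have "\<exists>N. \<forall>p\<ge>N. \<forall>q\<ge>N. dist (X p) (X q) < (1/2) ^ n" for n
    by (simp add: Cauchy_def)
  then obtain N where N: "\<And>n p q. p \<ge> N n \<Longrightarrow> q \<ge> N n \<Longrightarrow> dist (X p) (X q) < (1/2) ^ n"
    by metis
  \<comment> \<open>Partial sums make the chosen indices exceed all earlier thresholds as well.\<close>
  define r where "r n = sum N {..n}" for n
  have r: "r k \<ge> N n" if "k \<ge> n" for k n
    unfolding r_def using that by (intro member_le_sum) auto
  define F where "F n = rep_L2 (X n)" for n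
  have F: "square_integrable (F n)" and X: "X n = abs_L2 (F n)" for n
    by (simp_all add: F_def square_integrable_rep_L2 abs_rep_L2)
  have [measurable]: "F n \<in> borel_measurable circle" for n
    using F by (simp add: square_integrable_def)
  have F_dist: "(\<integral>\<^sup>+z. ennreal ((norm (F p z - F q z))\<^sup>2) \<partial>circle) \<le> ennreal ((1/4) ^ n)"
    if "p \<ge> N n" "q \<ge> N n" for p q n
  proof -
    have "(norm (X p - X q))\<^sup>2 \<le> ((1/2) ^ n)\<^sup>2"
      using N[OF that] by (intro power_mono) (simp_all add: dist_norm)
    also have "\<dots> = (1/4 :: real) ^ n"
      by (simp add: power2_eq_square flip: power_mult_distrib)
    finally show ?thesis
      by (simp add: X norm_diff_abs_L2[OF F F, symmetric] ennreal_leI)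
  qed
  have conv: "AE z in circle. convergent (\<lambda>k. F (r k) z)"
    by (rule AE_convergent_of_L2_fast_Cauchy) (auto intro!: F_dist r)
  define G where "G z = lim (\<lambda>k. F (r k) z)" for z
  have [measurable]: "G \<in> borel_measurable circle"
    unfolding G_def by measurable
  have F_G: "(\<integral>\<^sup>+z. ennreal ((norm (F m z - G z))\<^sup>2) \<partial>circle) \<le> ennreal ((1/4) ^ n)"
    if "m \<ge> N n" for m n
  proof -
    have "AE z in circle. ennreal ((norm (F m z - G z))\<^sup>2)
        = liminf (\<lambda>k. ennreal ((norm (F m z - F (r k) z))\<^sup>2))"
      using conv
    proof eventually_elim
      case (elim z)
      then have "(\<lambda>k. F (r k) z) \<longlonglongrightarrow> G z"
        by (simp add: G_def convergent_LIMSEQ_iff)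
      then have "(\<lambda>k. ennreal ((norm (F m z - F (r k) z))\<^sup>2)) \<longlonglongrightarrow> ennreal ((norm (F m z - G z))\<^sup>2)"
        by (intro tendsto_intros)
      from lim_imp_Liminf[OF sequentially_bot this] show ?case
        by (rule sym)
    qed
    then have "(\<integral>\<^sup>+z. ennreal ((norm (F m z - G z))\<^sup>2) \<partial>circle)
        = (\<integral>\<^sup>+z. liminf (\<lambda>k. ennreal ((norm (F m z - F (r k) z))\<^sup>2)) \<partial>circle)"
      by (rule nn_integral_cong_AE)
    also have "\<dots> \<le> liminf (\<lambda>k. \<integral>\<^sup>+z. ennreal ((norm (F m z - F (r k) z))\<^sup>2) \<partial>circle)"
      by (rule nn_integral_liminf) measurable
    also have "\<dots> \<le> liminf (\<lambda>k. ennreal ((1/4) ^ n))"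
      using that by (intro Liminf_mono eventually_sequentiallyI[of n] F_dist r)
    also have "\<dots> = ennreal ((1/4) ^ n)"
      by (simp add: Liminf_const)
    finally show ?thesis .
  qed
  have "square_integrable (\<lambda>z. F (N 0) z - G z)"
    unfolding square_integrable_def
    by (auto intro!: integrableI_bounded le_less_trans[OF F_G[OF order.refl]])
  \<comment> \<open>The limit \<open>G\<close> is \<open>F (N 0)\<close> minus this difference.\<close>
  from square_integrable_diff[OF F[of "N 0"] this] have G: "square_integrable G"
    by simp
  have "X \<longlonglongrightarrow> abs_L2 G"
  proof (rule metric_LIMSEQ_I)
    fix e :: real assume "0 < e"
    then obtain n where n: "(1/2) ^ n < e"
      using real_arch_pow_inv[of e "1/2"] by auto
    have "dist (X m) (abs_L2 G) < e" if "m \<ge> N n" for m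
    proof -
      have "(norm (X m - abs_L2 G))\<^sup>2 \<le> (1/4) ^ n"
        using F_G[OF that] by (simp add: X norm_diff_abs_L2[OF F G, symmetric])
      also have "\<dots> = ((1/2) ^ n)\<^sup>2"
        by (simp add: power2_eq_square flip: power_mult_distrib)
      finally have "norm (X m - abs_L2 G) \<le> (1/2) ^ n"
        by (rule power2_le_imp_le) simp
      with n show ?thesis
        by (simp add: dist_norm)
    qed
    then show "\<exists>M. \<forall>m\<ge>M. dist (X m) (abs_L2 G) < e" by blast
  qed
  then show "convergent X" by (rule convergentI)
qed

section \<open>Complex structure and multiplication operators\<close>

lemma L2_cinner_add_left: "L2_cinner (f + g) h = L2_cinner f h + L2_cinner g h"
  by transfer (simp add: L2_rel_def distrib_right square_integrable_integrable_mult_cnj)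

lemma L2_cinner_diff_left: "L2_cinner (f - g) h = L2_cinner f h - L2_cinner g h"
  using L2_cinner_add_left[of "f - g" g h] by simp

lemma L2_cinner_zero_left: "L2_cinner 0 h = 0"
  using L2_cinner_diff_left[of h h h] by simp

lemma L2_cinner_scaleC_left: "L2_cinner (L2_scaleC c f) g = c * L2_cinner f g"
  by transfer (simp add: mult.assoc)

lemma L2_cinner_scaleC_right: "L2_cinner f (L2_scaleC c g) = cnj c * L2_cinner f g"
proof transfer
  fix f c g
  have "(\<lambda>z. f z * cnj (c * g z)) = (\<lambda>z::complex. cnj c * (f z * cnj (g z)))"
    by (simp add: fun_eq_iff ac_simps)
  then show "(\<integral>z. f z * cnj (c * g z) \<partial>circle) = cnj c * (\<integral>z. f z * cnj (g z) \<partial>circle)"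
    by simp
qed

lemma L2_scaleC_diff: "L2_scaleC c (f - g) = L2_scaleC c f - L2_scaleC c g"
  by transfer (auto simp: L2_rel_def right_diff_distrib intro: square_integrable_diff square_integrable_cmult)

lemma closed_csubspace_subspace: "closed_csubspace M \<Longrightarrow> subspace M"
  unfolding subspace_def by (auto simp: closed_csubspace_def scaleR_L2_def)

lemma closed_csubspace_diff:
  assumes "closed_csubspace M" "f \<in> M" "g \<in> M" shows "f - g \<in> M"
  using closed_csubspace_subspace[OF assms(1)] assms(2,3) by (rule subspace_diff)

lemma Linf_cnj: "a \<in> Linf \<Longrightarrow> (\<lambda>z. cnj (a z)) \<in> Linf"
  by (auto simp: Linf_def)

lemma Linf_mult:
  assumes "a \<in> Linf" "b \<in> Linf"
  shows "(\<lambda>z. a z * b z) \<in> Linf"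
proof -
  obtain A B where meas: "a \<in> borel_measurable circle" "b \<in> borel_measurable circle"
    and bnd: "AE z in circle. norm (a z) \<le> A" "AE z in circle. norm (b z) \<le> B"
    using assms by (auto simp: Linf_def)
  from bnd have "AE z in circle. norm (a z * b z) \<le> A * B"
    by eventually_elim (auto simp: norm_mult intro!: mult_mono intro: order_trans[OF norm_ge_zero])
  with meas show ?thesis
    by (auto simp: Linf_def)
qed

lemma square_integrable_mult_Linf:
  "a \<in> Linf \<Longrightarrow> square_integrable f \<Longrightarrow> square_integrable (\<lambda>z. a z * f z)"
  by (auto simp: Linf_def intro: square_integrable_mult_bounded)

lemma mult_op_add: "mult_op a (f + g) = mult_op a f + mult_op a g"
  by transfer (auto simp: L2_rel_def distrib_left square_integrable_zero
      intro!: square_integrable_mult_Linf square_integrable_add)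

lemma mult_op_diff: "mult_op a (f - g) = mult_op a f - mult_op a g"
  using mult_op_add[of a "f - g" g] by (simp add: eq_diff_eq)

lemma mult_op_scaleC: "mult_op a (L2_scaleC c f) = L2_scaleC c (mult_op a f)"
  by transfer (auto simp: L2_rel_def mult.left_commute square_integrable_zero
      intro!: square_integrable_mult_Linf square_integrable_cmult)

lemma mult_op_mult:
  assumes "a \<in> Linf" "b \<in> Linf" "c \<in> Linf" "AE z in circle. c z = a z * b z"
  shows "mult_op a (mult_op b f) = mult_op c f"
  using assms by transfer (auto simp: L2_rel_def square_integrable_mult_Linf)

lemma mult_op_inverse:
  assumes "a \<in> Linf" "b \<in> Linf" "AE z in circle. a z * b z = 1"
  shows "mult_op a (mult_op b f) = f"
  using assms
proof transfer
  fix a b f assume ab: "a \<in> Linf" "b \<in> Linf" "AE z in circle. a z * b z = 1" and f: "L2_rel f f"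
  from ab(3) have "AE z in circle. a z * (b z * f z) = f z"
    by eventually_elim (simp flip: mult.assoc)
  with ab f show "L2_rel (if a \<in> Linf then \<lambda>z. a z * (if b \<in> Linf then \<lambda>z. b z * f z else (\<lambda>_. 0)) z
      else (\<lambda>_. 0)) f"
    by (simp add: L2_rel_def square_integrable_mult_Linf)
qed

lemma L2_cinner_mult_op_cnj:
  assumes "a \<in> Linf"
  shows "L2_cinner (mult_op (\<lambda>z. cnj (a z)) f) g = L2_cinner f (mult_op a g)"
  using assms Linf_cnj[OF assms] by transfer (simp add: ac_simps)

lemma mult_op_bounded:
  assumes "a \<in> Linf"
  shows "\<exists>C\<ge>0. \<forall>f. norm (mult_op a f) \<le> C * norm f"
proof -
  from assms obtain C where C: "AE z in circle. norm (a z) \<le> C"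
    by (auto simp: Linf_def)
  have "norm (mult_op a f) \<le> \<bar>C\<bar> * norm f" for f
  proof -
    have F: "square_integrable (rep_L2 f)" by (rule square_integrable_rep_L2)
    note aF = square_integrable_mult_Linf[OF assms F]
    have [measurable]: "rep_L2 f \<in> borel_measurable circle"
      using F by (simp add: square_integrable_def)
    have eq: "ennreal ((norm (abs_L2 G))\<^sup>2) = (\<integral>\<^sup>+z. ennreal ((norm (G z))\<^sup>2) \<partial>circle)"
      if "square_integrable G" for G
      using norm_diff_abs_L2[OF that square_integrable_zero]
      by (simp add: zero_L2_def[symmetric])
    have mf: "mult_op a f = abs_L2 (\<lambda>z. a z * rep_L2 f z)"
      using mult_op.abs_eq[OF L2_rel_rep, of a f] assms by (simp add: abs_rep_L2)
    have "ennreal ((norm (mult_op a f))\<^sup>2) = (\<integral>\<^sup>+z. ennreal ((norm (a z * rep_L2 f z))\<^sup>2) \<partial>circle)"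
      unfolding mf by (rule eq[OF aF])
    also have "\<dots> \<le> (\<integral>\<^sup>+z. ennreal (C\<^sup>2) * ennreal ((norm (rep_L2 f z))\<^sup>2) \<partial>circle)"
      using C
      by (intro nn_integral_mono_AE, eventually_elim)
        (auto simp: norm_mult power_mult_distrib ennreal_mult[symmetric]
          intro!: ennreal_leI mult_right_mono power_mono)
    also have "\<dots> = ennreal (C\<^sup>2) * ennreal ((norm f)\<^sup>2)"
      using eq[OF F] by (simp add: nn_integral_cmult abs_rep_L2)
    finally have "(norm (mult_op a f))\<^sup>2 \<le> (\<bar>C\<bar> * norm f)\<^sup>2"
      by (simp add: ennreal_mult[symmetric] power_mult_distrib)
    then show ?thesis
      by (rule power2_le_imp_le) simp
  qed
  then show ?thesis
    by (intro exI[of _ "\<bar>C\<bar>"]) simp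
qed

section \<open>Orthogonal projections of \<open>L\<^sup>2\<close>\<close>

text \<open>
  Two candidates differ by an element of \<open>N\<close> that is orthogonal to \<open>N\<close>, hence to itself.
\<close>

lemma orth_proj_unique:
  assumes "closed_csubspace N" "g \<in> N" "\<And>h. h \<in> N \<Longrightarrow> L2_cinner (f - g) h = 0"
  shows "orth_proj N f = g"
  unfolding orth_proj_def
proof (rule the_equality)
  fix g' assume g': "g' \<in> N \<and> (\<forall>h\<in>N. L2_cinner (f - g') h = 0)"
  then have "g - g' \<in> N"
    using closed_csubspace_diff assms(1,2) by blast
  then have "L2_cinner (f - g') (g - g') - L2_cinner (f - g) (g - g') = 0"
    using g' assms(3) by simp
  then have "L2_cinner (g - g') (g - g') = 0"
    by (simp flip: L2_cinner_diff_left)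
  then show "g' = g"
    by (simp add: L2_cinner_self)
qed (use assms in auto)

text \<open>
  The projection theorem for the real inner product controls only the real part of the complex
  one; applying it to \<open>\<i> h\<close> as well controls the imaginary part.
\<close>

lemma orth_proj_exists:
  assumes "closed_csubspace N"
  shows "\<exists>g\<in>N. \<forall>h\<in>N. L2_cinner (f - g) h = 0"
proof -
  have "Topological_Spaces.complete N"
    using assms by (simp add: complete_eq_closed closed_csubspace_def)
  then obtain g where "g \<in> N" and g: "\<And>h. h \<in> N \<Longrightarrow> inner (f - g) h = 0"
    using complete_subspace_orthogonal_decomposition closed_csubspace_subspace[OF assms] by blast
  have "L2_cinner (f - g) h = 0" if "h \<in> N" for h
  proof -
    have "L2_scaleC \<i> h \<in> N"
      using assms that by (simp add: closed_csubspace_def)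
    from g[OF that] g[OF this] show ?thesis
      by (simp add: inner_L2_def L2_cinner_scaleC_right complex_eq_iff)
  qed
  with \<open>g \<in> N\<close> show ?thesis by blast
qed

lemma
  assumes "closed_csubspace N"
  shows orth_proj_in: "orth_proj N f \<in> N"
    and orth_proj_orthogonal: "h \<in> N \<Longrightarrow> L2_cinner (f - orth_proj N f) h = 0"
proof -
  obtain g where "g \<in> N" and g: "\<And>h. h \<in> N \<Longrightarrow> L2_cinner (f - g) h = 0"
    using orth_proj_exists[OF assms] by blast
  moreover from this have "orth_proj N f = g"
    by (rule orth_proj_unique[OF assms])
  ultimately show "orth_proj N f \<in> N" "h \<in> N \<Longrightarrow> L2_cinner (f - orth_proj N f) h = 0"
    by simp_all
qed

lemma orth_proj_id: "closed_csubspace N \<Longrightarrow> f \<in> N \<Longrightarrow> orth_proj N f = f"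
  by (rule orth_proj_unique) (simp_all add: L2_cinner_zero_left)

lemma orth_proj_add:
  assumes "closed_csubspace N"
  shows "orth_proj N (f + g) = orth_proj N f + orth_proj N g"
proof (rule orth_proj_unique[OF assms])
  show "orth_proj N f + orth_proj N g \<in> N"
    using assms orth_proj_in[OF assms] by (simp add: closed_csubspace_def)
  fix h assume h: "h \<in> N"
  show "L2_cinner (f + g - (orth_proj N f + orth_proj N g)) h = 0"
    using orth_proj_orthogonal[OF assms h, of f] orth_proj_orthogonal[OF assms h, of g]
    by (simp add: L2_cinner_diff_left L2_cinner_add_left)
qed

lemma orth_proj_scaleC:
  assumes "closed_csubspace N"
  shows "orth_proj N (L2_scaleC c f) = L2_scaleC c (orth_proj N f)"
proof (rule orth_proj_unique[OF assms])
  show "L2_scaleC c (orth_proj N f) \<in> N"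
    using assms orth_proj_in[OF assms] by (simp add: closed_csubspace_def)
qed (simp add: L2_scaleC_diff[symmetric] L2_cinner_scaleC_left orth_proj_orthogonal[OF assms])

lemma norm_orth_proj_le:
  assumes "closed_csubspace N"
  shows "norm (orth_proj N f) \<le> norm f"
proof -
  let ?p = "orth_proj N f"
  have "inner (f - ?p) ?p = 0"
    using orth_proj_orthogonal[OF assms orth_proj_in[OF assms]] by (simp add: inner_L2_def)
  then have "(norm f)\<^sup>2 = (norm (f - ?p))\<^sup>2 + (norm ?p)\<^sup>2"
    by (simp add: power2_norm_eq_inner algebra_simps inner_commute)
  then have "(norm ?p)\<^sup>2 \<le> (norm f)\<^sup>2" by simp
  then show ?thesis by (rule power2_le_imp_le) simp
qed

section \<open>Generalized Toeplitz operators\<close>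

lemma bounded_operator_toeplitz:
  assumes "closed_csubspace M" "closed_csubspace N" "a \<in> Linf"
  shows "bounded_operator M N (toeplitz M N a)"
proof -
  obtain C where C: "\<And>f. norm (mult_op a f) \<le> C * norm f"
    using mult_op_bounded[OF assms(3)] by blast
  have "norm (toeplitz M N a f) \<le> C * norm f" if "f \<in> M" for f
    using that order_trans[OF norm_orth_proj_le[OF assms(2)] C] by (simp add: toeplitz_def)
  then show ?thesis
    using assms(1,2) unfolding bounded_operator_def
    by (auto simp: toeplitz_def closed_csubspace_def orth_proj_in orth_proj_add orth_proj_scaleC
        mult_op_add mult_op_scaleC assms(2))
qed

lemma toeplitz_eq_mult_op:
  assumes "closed_csubspace N" "mult_op a ` M \<subseteq> N"
  shows "toeplitz M N a = restrict (mult_op a) M"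
  unfolding toeplitz_def using assms by (intro restrict_ext orth_proj_id) auto

text \<open>
  For \<open>k \<in> K\<close> the function \<open>a k\<close> lies in \<open>H\<close>, so
  \<open>\<langle>cnj a (u - P\<^sub>H u), k\<rangle> = \<langle>u - P\<^sub>H u, a k\<rangle> = 0\<close>: replacing \<open>u\<close> by \<open>P\<^sub>H u\<close> changes
  \<open>cnj a u\<close> only by a function orthogonal to \<open>K\<close>.
\<close>

lemma orth_proj_mult_cnj_orth_proj:
  assumes "closed_csubspace H" "closed_csubspace K" "a \<in> Linf" "mult_op a ` K \<subseteq> H"
  shows "orth_proj K (mult_op (\<lambda>z. cnj (a z)) (orth_proj H u)) = orth_proj K (mult_op (\<lambda>z. cnj (a z)) u)"
proof (rule orth_proj_unique[OF assms(2) orth_proj_in[OF assms(2)]])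
  fix k assume k: "k \<in> K"
  let ?A = "mult_op (\<lambda>z. cnj (a z))"
  have "L2_cinner (u - orth_proj H u) (mult_op a k) = 0"
    using assms(4) k by (intro orth_proj_orthogonal[OF assms(1)]) auto
  then have "L2_cinner (?A u - ?A (orth_proj H u)) k = 0"
    by (simp add: L2_cinner_mult_op_cnj[OF assms(3)] flip: mult_op_diff)
  moreover have "L2_cinner (?A u - orth_proj K (?A u)) k = 0"
    by (rule orth_proj_orthogonal[OF assms(2) k])
  ultimately show "L2_cinner (?A (orth_proj H u) - orth_proj K (?A u)) k = 0"
    by (simp add: L2_cinner_diff_left)
qed

text \<open>
  The intermediate projection onto \<open>H\<close> is absorbed, and \<open>cnj a\<close> cancels \<open>cnj b\<close>.  Applied
  again with the roles of \<open>(a, K)\<close> and \<open>(b, H)\<close> exchanged, when \<open>b H = K\<close>, it gives the inverse on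
  the other side.
\<close>

lemma toeplitz_cnj_left_inverse:
  assumes "closed_csubspace H" "closed_csubspace K" "a \<in> Linf" "b \<in> Linf"
    and "AE z in circle. a z * b z = 1" and "mult_op a ` K \<subseteq> H"
  shows "compose K (toeplitz H K (\<lambda>z. cnj (a z))) (toeplitz K H (\<lambda>z. cnj (b z))) = (\<lambda>k\<in>K. k)"
proof -
  have ab: "AE z in circle. cnj (a z) * cnj (b z) = 1"
    using assms(5) by eventually_elim (simp flip: complex_cnj_mult)
  have "toeplitz H K (\<lambda>z. cnj (a z)) (toeplitz K H (\<lambda>z. cnj (b z)) k) = k" if "k \<in> K" for k
    using that assms(1,2)
    by (simp add: toeplitz_def orth_proj_in orth_proj_mult_cnj_orth_proj assms(3,6)
        mult_op_inverse[OF Linf_cnj Linf_cnj ab] assms(4) orth_proj_id)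
  then show ?thesis
    by (auto simp: compose_def)
qed

lemma mult_op_inverse_image:
  assumes "a \<in> Linf" "b \<in> Linf" "AE z in circle. b z * a z = 1" "mult_op a ` K = H"
  shows "mult_op b ` H = K"
proof -
  have "mult_op b (mult_op a f) = f" for f
    using assms(2,1,3) by (rule mult_op_inverse)
  then show ?thesis
    by (auto simp: assms(4)[symmetric] image_image)
qed

lemma GLinf_inverse:
  assumes "a \<in> GLinf"
  shows "a \<in> Linf" "(\<lambda>z. 1 / a z) \<in> Linf"
    "AE z in circle. a z * (1 / a z) = 1" "AE z in circle. (1 / a z) * a z = 1"
  using assms by (auto simp: GLinf_def)

lemma invertible_toeplitz_cnj:
  assumes "closed_csubspace H" "closed_csubspace K" "a \<in> GLinf" "mult_op a ` K = H"
  shows "invertible_operator H K (toeplitz H K (\<lambda>z. cnj (a z)))"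
proof -
  define b where "b z = 1 / a z" for z
  have b: "a \<in> Linf" "b \<in> Linf" "AE z in circle. a z * b z = 1" "AE z in circle. b z * a z = 1"
    using GLinf_inverse[OF assms(3)] unfolding b_def .
  have bH: "mult_op b ` H = K"
    by (rule mult_op_inverse_image[OF b(1,2,4) assms(4)])
  show ?thesis
    unfolding invertible_operator_def
  proof (intro conjI exI[of _ "toeplitz K H (\<lambda>z. cnj (b z))"])
    show "compose H (toeplitz K H (\<lambda>z. cnj (b z))) (toeplitz H K (\<lambda>z. cnj (a z))) = (\<lambda>f\<in>H. f)"
      using assms b bH by (intro toeplitz_cnj_left_inverse) auto
    show "compose K (toeplitz H K (\<lambda>z. cnj (a z))) (toeplitz K H (\<lambda>z. cnj (b z))) = (\<lambda>g\<in>K. g)"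
      using assms b by (intro toeplitz_cnj_left_inverse) auto
  qed (use assms b in \<open>auto intro!: bounded_operator_toeplitz Linf_cnj\<close>)
qed

lemma invertible_toeplitz_mult:
  assumes "closed_csubspace H" "closed_csubspace K" "a \<in> GLinf" "mult_op a ` K = H"
  shows "invertible_operator K H (toeplitz K H a)"
proof -
  define b where "b z = 1 / a z" for z
  have b: "a \<in> Linf" "b \<in> Linf" "AE z in circle. a z * b z = 1" "AE z in circle. b z * a z = 1"
    using GLinf_inverse[OF assms(3)] unfolding b_def .
  have bH: "mult_op b ` H = K"
    by (rule mult_op_inverse_image[OF b(1,2,4) assms(4)])
  have T: "toeplitz K H a = restrict (mult_op a) K" "toeplitz H K b = restrict (mult_op b) H"
    using assms bH by (auto intro!: toeplitz_eq_mult_op)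
  show ?thesis
    unfolding invertible_operator_def
  proof (intro conjI exI[of _ "toeplitz H K b"])
    show "compose K (toeplitz H K b) (toeplitz K H a) = (\<lambda>f\<in>K. f)"
      using assms(4) b by (auto simp: T compose_def mult_op_inverse intro!: restrict_ext)
    show "compose H (toeplitz K H a) (toeplitz H K b) = (\<lambda>f\<in>H. f)"
      using bH b by (auto simp: T compose_def mult_op_inverse intro!: restrict_ext)
  qed (use assms b in \<open>auto intro!: bounded_operator_toeplitz\<close>)
qed

text \<open>
  The middle projection onto \<open>H2\<close> is absorbed by the adjoint of \<open>a2\<close>, and the one onto \<open>H1\<close> acts
  as the identity on \<open>a1 K1\<close>.
\<close>

lemma toeplitz_factorization:
  assumes "closed_csubspace H1" "closed_csubspace H2" "closed_csubspace K2"
    and "a1 \<in> Linf" "a2 \<in> Linf" "\<phi> \<in> Linf" "\<psi> \<in> Linf"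
    and "mult_op a1 ` K1 \<subseteq> H1" "mult_op a2 ` K2 \<subseteq> H2"
    and \<phi>: "AE z in circle. \<phi> z = cnj (a2 z) * \<psi> z * a1 z"
  shows "toeplitz K1 K2 \<phi> =
    compose K1 (toeplitz H2 K2 (\<lambda>z. cnj (a2 z))) (compose K1 (toeplitz H1 H2 \<psi>) (toeplitz K1 H1 a1))"
proof -
  have a2: "(\<lambda>z. cnj (a2 z)) \<in> Linf"
    using assms(5) by (rule Linf_cnj)
  have \<psi>a1: "(\<lambda>z. \<psi> z * a1 z) \<in> Linf"
    using assms(7,4) by (rule Linf_mult)
  have "orth_proj K2 (mult_op \<phi> f) = toeplitz H2 K2 (\<lambda>z. cnj (a2 z))
      (toeplitz H1 H2 \<psi> (toeplitz K1 H1 a1 f))" if "f \<in> K1" for f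
  proof -
    have "mult_op a1 f \<in> H1"
      using assms(8) that by auto
    then have "toeplitz H2 K2 (\<lambda>z. cnj (a2 z)) (toeplitz H1 H2 \<psi> (toeplitz K1 H1 a1 f))
        = orth_proj K2 (mult_op (\<lambda>z. cnj (a2 z)) (orth_proj H2 (mult_op \<psi> (mult_op a1 f))))"
      using assms(1,2) that by (simp add: toeplitz_def orth_proj_id orth_proj_in)
    also have "\<dots> = orth_proj K2 (mult_op (\<lambda>z. cnj (a2 z)) (mult_op \<psi> (mult_op a1 f)))"
      by (rule orth_proj_mult_cnj_orth_proj[OF assms(2,3,5,9)])
    also have "mult_op \<psi> (mult_op a1 f) = mult_op (\<lambda>z. \<psi> z * a1 z) f"
      by (rule mult_op_mult[OF assms(7,4) \<psi>a1]) simp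
    also have "mult_op (\<lambda>z. cnj (a2 z)) \<dots> = mult_op \<phi> f"
      using \<phi> by (intro mult_op_mult[OF a2 \<psi>a1 assms(6)]) (simp add: mult.assoc)
    finally show ?thesis by simp
  qed
  then show ?thesis
    by (auto simp: compose_def toeplitz_def[of K1 K2] intro!: restrict_ext)
qed

theorem theorem2p13:
  fixes H1 H2 K1 K2 :: "L2 set" and a1 a2 \<phi> \<psi> :: "complex \<Rightarrow> complex"
  assumes "closed_csubspace H1" and "closed_csubspace H2"
    and "closed_csubspace K1" and "closed_csubspace K2"
    and "a1 \<in> GLinf" and "a2 \<in> GLinf"
    and "mult_op a1 ` K1 = H1" and "mult_op a2 ` K2 = H2"
    and "\<phi> \<in> GLinf" and "\<psi> \<in> GLinf"
    and "AE z in circle. \<phi> z = cnj (a2 z) * \<psi> z * a1 z"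
  shows "let E = toeplitz H2 K2 (\<lambda>z. cnj (a2 z)); F = toeplitz K1 H1 a1 in
      toeplitz K1 K2 \<phi> = compose K1 E (compose K1 (toeplitz H1 H2 \<psi>) F) \<and>
      F = restrict (mult_op a1) K1 \<and>
      invertible_operator H2 K2 E \<and> invertible_operator K1 H1 F \<and>
      equivalent_operators K1 K2 (toeplitz K1 K2 \<phi>) H1 H2 (toeplitz H1 H2 \<psi>)"
proof -
  have Linf: "a1 \<in> Linf" "a2 \<in> Linf" "\<phi> \<in> Linf" "\<psi> \<in> Linf"
    using assms by (auto simp: GLinf_def)
  let ?E = "toeplitz H2 K2 (\<lambda>z. cnj (a2 z))" and ?F = "toeplitz K1 H1 a1"
  have fact: "toeplitz K1 K2 \<phi> = compose K1 ?E (compose K1 (toeplitz H1 H2 \<psi>) ?F)"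
    using assms Linf by (intro toeplitz_factorization) auto
  have E: "invertible_operator H2 K2 ?E"
    using assms by (intro invertible_toeplitz_cnj)
  have F: "invertible_operator K1 H1 ?F"
    using assms by (intro invertible_toeplitz_mult)
  have "equivalent_operators K1 K2 (toeplitz K1 K2 \<phi>) H1 H2 (toeplitz H1 H2 \<psi>)"
    unfolding equivalent_operators_def
    using fact E F assms Linf bounded_operator_toeplitz by blast
  moreover have "?F = restrict (mult_op a1) K1"
    using assms by (intro toeplitz_eq_mult_op) auto
  ultimately show ?thesis
    using fact E F by (simp only: Let_def simp_thms)
qed

end
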